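(* Let $n\ge 4$ and let $K_n^+$ be the graph obtained from the complete graph $K_n$ by subdividing exactly one edge exactly once. Then (i) $\sigma^{\boxtimes}_{V}(K_n^+)=\sigma^{\boxtimes}_{E}(K_n^+)=2$; (ii) $\sigma^{\times}_{V}(K_n^+)=2$ and $\sigma^{\times}_{E}(K_n^+)=1$; (iii) $\sigma^{\square}_{V}(K_n^+)=\sigma^{\square}_{E}(K_n^+)=1$.
   Context: All graphs are finite, simple, nonempty and connected; $\mathbb{N}_l=\{1,\dots,l\}$ (with $\mathbb{N}_0=\emptyset$), and $d_G$ is the usual shortest-path distance. Subdividing an edge $uv$ of a graph means replacing the edge $uv$ by a path $uwv$ through a new vertex $w$. Let $G$ be a graph and $l\in\mathbb{N}$, $l\ge 1$. A surjective function $f:\mathbb{N}_l\to V(G)$ is an $l$-track on $G$ if $f(i)f(i+1)\in E(G)$ for every $i\in\mathbb{N}_{l-1}$; it is a lazy $l$-track if for every $i\in\mathbb{N}_{l-1}$ either $f(i)f(i+1)\in E(G)$ or $f(i)=f(i+1)$. An $l$-sweep (respectively lazy $l$-sweep) is an $l$-track (respectively lazy $l$-track) $f$ such that for every edge $uv\in E(G)$ there is $i\in\mathbb{N}_{l-1}$ with $f(i)f(i+1)=uv$ (as unordered pairs). Two lazy $l$-tracks (in particular, lazy $l$-sweeps) $f,g$ are opposite if for all $i\in\mathbb{N}_{l-1}$: $f(i)f(i+1)\in E(G)\iff g(i)=g(i+1)$. For lazy $l$-tracks $f,g$ put $m_G(f,g)=\min\{d_G(f(i),g(i)) : i\in\mathbb{N}_l\}$.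 Edge spans: the strong edge span $\sigma^{\boxtimes}_E(G)$, the direct edge span $\sigma^{\times}_E(G)$ and the Cartesian edge span $\sigma^{\square}_E(G)$ are the maximum of $m_G(f,g)$ over all $l$ and all pairs $(f,g)$ of, respectively, lazy $l$-sweeps, $l$-sweeps, opposite lazy $l$-sweeps on $G$. Vertex spans: $\sigma^{\boxtimes}_V(G)$, $\sigma^{\times}_V(G)$, $\sigma^{\square}_V(G)$ are the maximum of $m_G(f,g)$ over all $l$ and all pairs $(f,g)$ of, respectively, lazy $l$-tracks, $l$-tracks, opposite lazy $l$-tracks on $G$. *)

theory Defs
  imports "Graph_Theory.Graph_Theory"
begin

text \<open>
  A finite simple graph is, as in the AFP entry Graph-Theory, a symmetric digraph satisfying
  the locale predicate \<^locale>\<open>graph\<close>; \<open>u \<rightarrow>\<^bsub>G\<^esub> v\<close> says that \<open>uv\<close> is an edge of \<open>G\<close>.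
  The set \<open>{1, \<dots>, l}\<close> is \<open>{1..l}\<close>, and a function on it is a function on \<^typ>\<open>nat\<close>
  of which only the values on \<open>{1..l}\<close> matter.
\<close>

definition graph_dist :: "('a, 'b) pre_digraph \<Rightarrow> 'a \<Rightarrow> 'a \<Rightarrow> nat" where
  "graph_dist G u v = (LEAST k. \<exists>p. pre_digraph.apath G u p v \<and> length p = k)"

text \<open>
  Between connected vertices this is the library's weighted distance for unit weights.
\<close>

lemma (in wf_digraph) \<mu>_unit_eq_graph_dist:
  assumes "u \<rightarrow>\<^sup>* v"
  shows "\<mu> (\<lambda>_. 1) u v = ereal (real (graph_dist G u v))"
proof -
  have cost: "awalk_cost (\<lambda>_. 1) p = real (length p)" for p :: "'b awalk"
    by (induction p) auto
  have ex: "\<exists>k p. apath u p v \<and> length p = k"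
    using assms by (auto simp: reachable_apath)
  obtain p where p: "apath u p v" "length p = graph_dist G u v"
    unfolding graph_dist_def using LeastI_ex[OF ex] by blast
  have le: "graph_dist G u v \<le> length q" if "awalk u q v" for q
  proof -
    have "graph_dist G u v \<le> length (awalk_to_apath q)"
      unfolding graph_dist_def
      using apath_awalk_to_apath[OF that] by (intro Least_le) blast
    also have "\<dots> \<le> length q"
      using awalk_to_path_no_neg_cyc_cost[OF that, of "\<lambda>_. 1"] by (simp add: cost)
    finally show ?thesis .
  qed
  show ?thesis
    unfolding \<mu>_def cost
  proof (rule antisym)
    show "(INF q\<in>{q. awalk u q v}. ereal (real (length q))) \<le> ereal (real (graph_dist G u v))"
      using p by (intro INF_lower2[of p]) (auto intro: awalkI_apath)
    show "ereal (real (graph_dist G u v)) \<le> (INF q\<in>{q. awalk u q v}. ereal (real (length q)))"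
      using le by (intro INF_greatest) auto
  qed
qed

definition track :: "('a, 'b) pre_digraph \<Rightarrow> nat \<Rightarrow> (nat \<Rightarrow> 'a) \<Rightarrow> bool" where
  "track G l f \<longleftrightarrow> f ` {1..l} = verts G \<and> (\<forall>i\<in>{1..<l}. f i \<rightarrow>\<^bsub>G\<^esub> f (i + 1))"

definition lazy_track :: "('a, 'b) pre_digraph \<Rightarrow> nat \<Rightarrow> (nat \<Rightarrow> 'a) \<Rightarrow> bool" where
  "lazy_track G l f \<longleftrightarrow>
     f ` {1..l} = verts G \<and> (\<forall>i\<in>{1..<l}. f i \<rightarrow>\<^bsub>G\<^esub> f (i + 1) \<or> f i = f (i + 1))"

definition visits_edges :: "('a, 'b) pre_digraph \<Rightarrow> nat \<Rightarrow> (nat \<Rightarrow> 'a) \<Rightarrow> bool" where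
  "visits_edges G l f \<longleftrightarrow>
     (\<forall>u v. u \<rightarrow>\<^bsub>G\<^esub> v \<longrightarrow> (\<exists>i\<in>{1..<l}. {f i, f (i + 1)} = {u, v}))"

definition sweep :: "('a, 'b) pre_digraph \<Rightarrow> nat \<Rightarrow> (nat \<Rightarrow> 'a) \<Rightarrow> bool" where
  "sweep G l f \<longleftrightarrow> track G l f \<and> visits_edges G l f"

definition lazy_sweep :: "('a, 'b) pre_digraph \<Rightarrow> nat \<Rightarrow> (nat \<Rightarrow> 'a) \<Rightarrow> bool" where
  "lazy_sweep G l f \<longleftrightarrow> lazy_track G l f \<and> visits_edges G l f"

definition opposite :: "('a, 'b) pre_digraph \<Rightarrow> nat \<Rightarrow> (nat \<Rightarrow> 'a) \<Rightarrow> (nat \<Rightarrow> 'a) \<Rightarrow> bool" where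
  "opposite G l f g \<longleftrightarrow> (\<forall>i\<in>{1..<l}. f i \<rightarrow>\<^bsub>G\<^esub> f (i + 1) \<longleftrightarrow> g i = g (i + 1))"

definition min_dist :: "('a, 'b) pre_digraph \<Rightarrow> nat \<Rightarrow> (nat \<Rightarrow> 'a) \<Rightarrow> (nat \<Rightarrow> 'a) \<Rightarrow> nat" where
  "min_dist G l f g = Min {graph_dist G (f i) (g i) | i. i \<in> {1..l}}"

text \<open>
  For a finite connected graph the values of \<^const>\<open>min_dist\<close> are bounded by the number of
  vertices, so each \<^const>\<open>Max\<close> below is over a finite set.
\<close>

definition strong_vertex_span :: "('a, 'b) pre_digraph \<Rightarrow> nat" where
  "strong_vertex_span G =
     Max {min_dist G l f g | l f g. l \<ge> 1 \<and> lazy_track G l f \<and> lazy_track G l g}"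

definition direct_vertex_span :: "('a, 'b) pre_digraph \<Rightarrow> nat" where
  "direct_vertex_span G =
     Max {min_dist G l f g | l f g. l \<ge> 1 \<and> track G l f \<and> track G l g}"

definition cartesian_vertex_span :: "('a, 'b) pre_digraph \<Rightarrow> nat" where
  "cartesian_vertex_span G =
     Max {min_dist G l f g | l f g.
       l \<ge> 1 \<and> lazy_track G l f \<and> lazy_track G l g \<and> opposite G l f g}"

definition strong_edge_span :: "('a, 'b) pre_digraph \<Rightarrow> nat" where
  "strong_edge_span G =
     Max {min_dist G l f g | l f g. l \<ge> 1 \<and> lazy_sweep G l f \<and> lazy_sweep G l g}"

definition direct_edge_span :: "('a, 'b) pre_digraph \<Rightarrow> nat" where
  "direct_edge_span G =
     Max {min_dist G l f g | l f g. l \<ge> 1 \<and> sweep G l f \<and> sweep G l g}"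

definition cartesian_edge_span :: "('a, 'b) pre_digraph \<Rightarrow> nat" where
  "cartesian_edge_span G =
     Max {min_dist G l f g | l f g.
       l \<ge> 1 \<and> lazy_sweep G l f \<and> lazy_sweep G l g \<and> opposite G l f g}"

end

theory Submission
  imports Defs
begin

text \<open>
  Write \<open>R\<close> for the vertices of the complete graph other than the ends \<open>u\<close>, \<open>v\<close> of the subdivided
  edge, and \<open>w\<close> for the new vertex. The only pairs of distinct non-adjacent vertices are
  \<open>{u, v}\<close> and \<open>{w, r}\<close> with \<open>r \<in> R\<close>; such a pair has a common neighbour, so the diameter is 2 and
  no span exceeds 2. Call these pairs far.

  The lower bounds have a common shape. Regard a pair of (lazy) tracks as one walk of two tokens:
  a state is the pair of their positions, and the kind of span prescribes the allowed moves between
  states. If the states of a set \<open>S\<close> can be reached from each other by allowed moves inside \<open>S\<close>,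
  then a single walk performs all these moves (\<open>covering_chain\<close>), and its two coordinates are tracks
  whose distance is at least the minimum distance over \<open>S\<close> (\<open>tracks_of_moves\<close>). They are sweeps as
  soon as every edge is traversed in each coordinate by some move. The choices are:

  \<^item> strong spans and direct vertex span, bound 2: \<open>S\<close> consists of the far pairs. Every \<open>(w, r)\<close> and \<open>(r, w)\<close>
    can move to both \<open>(u, v)\<close> and \<open>(v, u)\<close> with both tokens moving, and back. If tokens may
    rest, an edge inside \<open>R\<close> is traversed while the other token waits on \<open>w\<close>.
  \<^item> direct edge span, bound 1: \<open>S\<close> consists of the arcs, and one token follows the other at a
    delay of one step. This works in every connected graph with an edge (\<open>shifted_sweeps\<close>).
  \<^item> Cartesian spans, bound 1: \<open>S\<close> consists of the pairs of distinct vertices, and one token moves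
    at a time. This works in every 2-connected graph (\<open>opposite_sweeps\<close>).

  For the upper bounds 1, suppose the tokens always form a far pair. When one token of a
  direct sweep traverses an edge inside \<open>R\<close>, the other one must be on \<open>w\<close> before and after this step,
  but it is not allowed to rest (\<open>sweeps_min_dist_le_1\<close>). In an opposite pair exactly one token
  moves in each step, and no such step leads from a far pair to a far pair if one of them is
  \<open>(u, v)\<close>; hence the first token never visits \<open>u\<close> (\<open>opposite_min_dist_le_1\<close>).
\<close>

section \<open>Distances and spans\<close>

lemma (in wf_digraph) graph_dist_le_length:
  assumes "awalk x p y"
  shows "graph_dist G x y \<le> length p"
proof -
  have cost: "awalk_cost (\<lambda>_. 1) p = real (length p)" for p :: "'b awalk"
    by (induction p) auto
  have "x \<rightarrow>\<^sup>* y"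
    using assms by (rule reachable_awalkI)
  then have "ereal (real (graph_dist G x y)) = \<mu> (\<lambda>_. 1) x y"
    by (simp add: \<mu>_unit_eq_graph_dist)
  also have "\<dots> \<le> ereal (real (length p))"
    unfolding \<mu>_def cost using assms by (intro INF_lower) simp
  finally show ?thesis by simp
qed

lemma (in wf_digraph) obtain_shortest_awalk:
  assumes "x \<rightarrow>\<^sup>* y"
  obtains p where "awalk x p y" "length p = graph_dist G x y"
proof -
  have "\<exists>k p. apath x p y \<and> length p = k"
    using assms by (auto simp: reachable_apath)
  from LeastI_ex[OF this] show ?thesis
    using that unfolding graph_dist_def by (blast intro: awalkI_apath)
qed

lemma (in wf_digraph) graph_dist_ge_1:
  assumes "x \<rightarrow>\<^sup>* y" "x \<noteq> y"
  shows "1 \<le> graph_dist G x y"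
proof -
  obtain p where p: "awalk x p y" "length p = graph_dist G x y"
    using obtain_shortest_awalk[OF assms(1)] .
  with assms(2) have "p \<noteq> []"
    by (auto simp: awalk_def)
  then show ?thesis
    using p(2) by (cases p) auto
qed

lemma (in wf_digraph) graph_dist_ge_2:
  assumes "x \<rightarrow>\<^sup>* y" "x \<noteq> y" "\<not> x \<rightarrow> y"
  shows "2 \<le> graph_dist G x y"
proof -
  obtain p where p: "awalk x p y" "length p = graph_dist G x y"
    using obtain_shortest_awalk[OF assms(1)] .
  have "length p \<noteq> 1"
  proof
    assume "length p = 1"
    then obtain e where "p = [e]"
      by (auto simp: length_Suc_conv)
    with p(1) have "x \<rightarrow> y"
      by (auto simp: awalk_def arcs_ends_conv)
    with assms(3) show False ..
  qed
  with graph_dist_ge_1[OF assms(1,2)] p(2) show ?thesis by simp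
qed

lemma (in wf_digraph) graph_dist_self:
  assumes "x \<in> verts G"
  shows "graph_dist G x x = 0"
  using graph_dist_le_length[of x "[]" x] assms by (simp add: awalk_def)

lemma (in wf_digraph) graph_dist_le_1:
  assumes "x \<rightarrow> y"
  shows "graph_dist G x y \<le> 1"
proof -
  obtain e where "e \<in> arcs G" "tail G e = x" "head G e = y"
    using assms by (rule reachableE)
  then have "awalk x [e] y"
    by (auto simp: awalk_def)
  from graph_dist_le_length[OF this] show ?thesis by simp
qed

lemma (in wf_digraph) graph_dist_le_2:
  assumes "x \<rightarrow> z" "z \<rightarrow> y"
  shows "graph_dist G x y \<le> 2"
proof -
  obtain d where "d \<in> arcs G" "tail G d = x" "head G d = z"
    using assms(1) by (rule reachableE)
  moreover obtain e where "e \<in> arcs G" "tail G e = z" "head G e = y"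
    using assms(2) by (rule reachableE)
  ultimately have "awalk x [d, e] y"
    by (auto simp: awalk_def)
  from graph_dist_le_length[OF this] show ?thesis by simp
qed

lemma min_dist_le:
  assumes "i \<in> {1..l}"
  shows "min_dist G l f g \<le> graph_dist G (f i) (g i)"
  unfolding min_dist_def using assms
  by (intro Min_le) (auto simp: setcompr_eq_image)

lemma min_dist_ge:
  assumes "1 \<le> l" and "\<And>i. i \<in> {1..l} \<Longrightarrow> k \<le> graph_dist G (f i) (g i)"
  shows "k \<le> min_dist G l f g"
  unfolding min_dist_def using assms
  by (subst Min_ge_iff) (auto simp: setcompr_eq_image)

text \<open>
  The upper bound \<open>k\<close> also supplies the finiteness without which \<^const>\<open>Max\<close> would be unspecified.
\<close>

lemma Max_nat_eqI:
  fixes A :: "nat set"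
  assumes "\<And>x. x \<in> A \<Longrightarrow> x \<le> k" and "x \<in> A" and "k \<le> x"
  shows "Max A = k"
proof (rule Max_eqI)
  show "finite A"
    using assms(1) by (meson finite_nat_set_iff_bounded_le)
  show "k \<in> A"
    using assms le_antisym by metis
qed (use assms(1) in auto)

section \<open>Walks of a pair of tokens\<close>

lemma chain_extend:
  fixes s :: "nat \<Rightarrow> 's"
  assumes "(s l, x) \<in> M\<^sup>*" and "1 \<le> l" and "\<forall>i\<in>{1..<l}. (s i, s (i + 1)) \<in> M"
  shows "\<exists>l' s'. l \<le> l' \<and> s' l' = x \<and> (\<forall>i\<in>{1..l}. s' i = s i)
    \<and> (\<forall>i\<in>{1..<l'}. (s' i, s' (i + 1)) \<in> M)"
  using assms(1)
proof (induction rule: rtrancl_induct)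
  case base
  then show ?case using assms(3) by blast
next
  case (step y z)
  then obtain l' s' where s': "l \<le> l'" "s' l' = y" "\<forall>i\<in>{1..l}. s' i = s i"
      "\<forall>i\<in>{1..<l'}. (s' i, s' (i + 1)) \<in> M"
    by blast
  let ?s = "s'(l' + 1 := z)"
  have "(?s i, ?s (i + 1)) \<in> M" if "i \<in> {1..<l' + 1}" for i
    using s' step.hyps(2) that by (cases "i = l'") auto
  then show ?case
    using s'(1,3) by (intro exI[of _ "l' + 1"] exI[of _ ?s]) auto
qed

text \<open>
  The arcs of \<open>A\<close> are appended one after the other: by strong connectedness a chain can be prolonged
  from its last state to the source of the next arc.
\<close>

lemma covering_chain_arcs:
  assumes "finite A" and "A \<subseteq> M" and "M \<subseteq> S \<times> S" and "c \<in> S"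
    and conn: "S \<times> S \<subseteq> M\<^sup>*"
  shows "\<exists>(l::nat) s. 1 \<le> l \<and> s 1 = c \<and> (\<forall>i\<in>{1..<l}. (s i, s (i + 1)) \<in> M)
    \<and> (\<forall>e\<in>A. \<exists>i\<in>{1..<l}. (s i, s (i + 1)) = e)"
  using assms(1,2)
proof (induction rule: finite_induct)
  case empty
  show ?case by (intro exI[of _ "1::nat"] exI[of _ "\<lambda>_. c"]) auto
next
  case (insert e A)
  obtain a b where e: "e = (a, b)" by (cases e)
  from insert obtain l :: nat and s where s: "1 \<le> l" "s 1 = c" "\<forall>i\<in>{1..<l}. (s i, s (i + 1)) \<in> M"
      "\<forall>e\<in>A. \<exists>i\<in>{1..<l}. (s i, s (i + 1)) = e"
    by blast
  have "(c, s l) \<in> M\<^sup>*"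
  proof -
    have "(c, s i) \<in> M\<^sup>*" if "1 \<le> i" "i \<le> l" for i
      using that
    proof (induction i rule: dec_induct)
      case base
      then show ?case using s(2) by simp
    next
      case (step n)
      then have "(s n, s (n + 1)) \<in> M"
        using s(3) by auto
      with step show ?case by (auto intro: rtrancl_into_rtrancl)
    qed
    with s(1) show ?thesis by blast
  qed
  then have "s l \<in> S"
    using assms(3,4) by (cases rule: rtranclE) auto
  moreover have "a \<in> S" and ab: "(a, b) \<in> M"
    using insert.prems assms(3) e by auto
  ultimately obtain l' s' where s': "l \<le> l'" "s' l' = a" "\<forall>i\<in>{1..l}. s' i = s i"
      "\<forall>i\<in>{1..<l'}. (s' i, s' (i + 1)) \<in> M"
    using chain_extend[of s l a M] conn s(1,3) by blast
  let ?s = "s'(l' + 1 := b)"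
  have "(?s i, ?s (i + 1)) \<in> M" if "i \<in> {1..<l' + 1}" for i
    using s' ab that by (cases "i = l'") auto
  moreover have "\<exists>i\<in>{1..<l' + 1}. (?s i, ?s (i + 1)) = d" if "d \<in> insert e A" for d
  proof (cases "d = e")
    case True
    then show ?thesis using s(1) s'(1,2) e by (intro bexI[of _ l']) auto
  next
    case False
    then have "d \<in> A" using that by blast
    with s(4) obtain i where i: "i \<in> {1..<l}" "(s i, s (i + 1)) = d" by blast
    have "i \<in> {1..l}" "i + 1 \<in> {1..l}"
      using i(1) by auto
    then have "s' i = s i" "s' (i + 1) = s (i + 1)"
      using s'(3) by blast+
    moreover have "i \<in> {1..<l' + 1}" "i \<noteq> l' + 1" "i + 1 \<noteq> l' + 1"
      using i(1) s'(1) by auto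
    ultimately show ?thesis using i(2) by (intro bexI[of _ i]) simp_all
  qed
  ultimately show ?case
    using s(1,2) s'(1,3) by (intro exI[of _ "l' + 1"] exI[of _ ?s]) auto
qed

lemma covering_chain:
  assumes "finite S" and "S \<noteq> {}" and "M \<subseteq> S \<times> S"
    and conn: "S \<times> S \<subseteq> M\<^sup>*"
  obtains l :: nat and s where "1 \<le> l" "s ` {1..l} = S" "\<forall>i\<in>{1..<l}. (s i, s (i + 1)) \<in> M"
    "\<forall>e\<in>M. \<exists>i\<in>{1..<l}. (s i, s (i + 1)) = e"
proof -
  obtain c where c: "c \<in> S" using assms(2) by blast
  have "finite M" using assms(1,3) finite_subset by blast
  from covering_chain_arcs[OF this subset_refl assms(3) c conn]
  obtain l :: nat and s where s: "1 \<le> l" "s 1 = c" "\<forall>i\<in>{1..<l}. (s i, s (i + 1)) \<in> M"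
      "\<forall>e\<in>M. \<exists>i\<in>{1..<l}. (s i, s (i + 1)) = e"
    by blast
  have "s i \<in> S" if "1 \<le> i" "i \<le> l" for i
    using that
  proof (induction i rule: dec_induct)
    case base
    then show ?case using s(2) c by simp
  next
    case (step n)
    then have "(s n, s (n + 1)) \<in> M"
      using s(3) by auto
    with assms(3) show ?case by auto
  qed
  moreover have "p \<in> s ` {1..l}" if "p \<in> S" for p
  proof (cases "p = c")
    case True
    then show ?thesis using s(1,2) by auto
  next
    \<comment> \<open>A state other than \<open>c\<close> has an outgoing move, since it reaches \<open>c\<close>.\<close>
    case False
    moreover have "(p, c) \<in> M\<^sup>*"
      using conn that c by blast
    ultimately obtain q where "(p, q) \<in> M"
      by (metis converse_rtranclE)
    with s(4) show ?thesis by fastforce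
  qed
  ultimately have "s ` {1..l} = S" by auto
  with s that show thesis by blast
qed

text \<open>
  All lower bounds for spans come from this lemma. The states in \<open>S\<close> are joint positions of two tokens,
  \<open>M\<close> is the set of moves that are allowed in one step, and \<open>f\<close>, \<open>g\<close> are the two coordinates of one
  walk that performs every move. The choice of \<open>M\<close> makes \<open>f\<close> and \<open>g\<close> lazy, direct or opposite, and
  the last but one conclusion serves to show that they visit all edges.
\<close>

lemma (in wf_digraph) tracks_of_moves:
  fixes S :: "('a \<times> 'a) set"
  assumes "S \<noteq> {}" and "M \<subseteq> S \<times> S" and "finite (verts G)"
    and "S \<times> S \<subseteq> M\<^sup>*"
    and "fst ` S = verts G" and "snd ` S = verts G"
    and dist: "\<And>x y. (x, y) \<in> S \<Longrightarrow> k \<le> graph_dist G x y"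
  obtains l f g where "1 \<le> l" "f ` {1..l} = verts G" "g ` {1..l} = verts G"
    "\<And>i. i \<in> {1..<l} \<Longrightarrow> ((f i, g i), (f (i + 1), g (i + 1))) \<in> M"
    "\<And>x y x' y'. ((x, y), (x', y')) \<in> M
      \<Longrightarrow> \<exists>i\<in>{1..<l}. f i = x \<and> g i = y \<and> f (i + 1) = x' \<and> g (i + 1) = y'"
    "k \<le> min_dist G l f g"
proof -
  have "S \<subseteq> verts G \<times> verts G"
    using assms(5,6) by force
  then have fin: "finite S"
    using assms(3) finite_subset by blast
  obtain l :: nat and s where s: "1 \<le> l" "s ` {1..l} = S"
      "\<forall>i\<in>{1..<l}. (s i, s (i + 1)) \<in> M" "\<forall>e\<in>M. \<exists>i\<in>{1..<l}. (s i, s (i + 1)) = e"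
    by (rule covering_chain[OF fin assms(1,2,4)])
  let ?f = "fst \<circ> s" and ?g = "snd \<circ> s"
  show thesis
  proof (rule that[of l ?f ?g])
    show "1 \<le> l" by fact
    show "?f ` {1..l} = verts G" "?g ` {1..l} = verts G"
      using s(2) assms(5,6) by (metis image_comp)+
    show "((?f i, ?g i), (?f (i + 1), ?g (i + 1))) \<in> M" if "i \<in> {1..<l}" for i
      using s(3) that by simp
    show "\<exists>i\<in>{1..<l}. ?f i = x \<and> ?g i = y \<and> ?f (i + 1) = x' \<and> ?g (i + 1) = y'"
      if "((x, y), (x', y')) \<in> M" for x y x' y'
    proof -
      obtain i where "i \<in> {1..<l}" "(s i, s (i + 1)) = ((x, y), (x', y'))"
        using s(4) \<open>((x, y), (x', y')) \<in> M\<close> by blast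
      then show ?thesis by (intro bexI[of _ i]) simp_all
    qed
    show "k \<le> min_dist G l ?f ?g"
    proof (rule min_dist_ge)
      show "k \<le> graph_dist G (?f i) (?g i)" if "i \<in> {1..l}" for i
        using s(2) that by (intro dist) auto
    qed fact
  qed
qed

lemma strongly_connected_relI:
  assumes "sym M" and hub: "\<And>p. p \<in> S \<Longrightarrow> (p, c) \<in> M\<^sup>*" and "p \<in> S" "q \<in> S"
  shows "(p, q) \<in> M\<^sup>*"
proof -
  have "(c, q) \<in> M\<^sup>*"
    using hub[OF assms(4)] sym_rtrancl[OF assms(1)] by (rule symD[rotated])
  with hub[OF assms(3)] show ?thesis by (rule rtrancl_trans)
qed

section \<open>Keeping two tokens apart in a general graph\<close>

text \<open>
  A move takes an arc \<open>(x, y)\<close> to an arc \<open>(y, z)\<close>: the first token steps to where the second one was.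
  The two tokens are always adjacent, in particular distinct.
\<close>

lemma (in graph) shifted_sweeps:
  assumes conn: "\<And>x y. x \<in> verts G \<Longrightarrow> y \<in> verts G \<Longrightarrow> x \<rightarrow>\<^sup>* y"
    and deg: "\<And>x. x \<in> verts G \<Longrightarrow> \<exists>y. x \<rightarrow> y" and "verts G \<noteq> {}"
  shows "\<exists>l f g. 1 \<le> l \<and> sweep G l f \<and> sweep G l g \<and> 1 \<le> min_dist G l f g"
proof -
  let ?S = "arcs_ends G" and ?M = "{((x, y), (y', z)). y' = y \<and> x \<rightarrow> y \<and> y \<rightarrow> z}"
  have sym: "y \<rightarrow> x" if "x \<rightarrow> y" for x y
    using that sym_arcs by (rule arcs_ends_symmetric[rotated])
  have in_verts: "x \<in> verts G" "y \<in> verts G" if "x \<rightarrow> y" for x y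
    using that by auto
  have reach: "\<exists>p. p \<rightarrow> a \<and> ((x, y), (p, a)) \<in> ?M\<^sup>*" if "y \<rightarrow>\<^sup>* a" "x \<rightarrow> y" for x y a
    using that
  proof (induction rule: reachable_induct)
    case base
    then show ?case by blast
  next
    case (step a b)
    then obtain p where p: "p \<rightarrow> a" "((x, y), (p, a)) \<in> ?M\<^sup>*" by blast
    then have "((x, y), (a, b)) \<in> ?M\<^sup>*"
      using step.hyps by (auto intro: rtrancl_into_rtrancl)
    then show ?case using step.hyps by blast
  qed
  have reach_pair: "(p, q) \<in> ?M\<^sup>*" if "p \<in> ?S" "q \<in> ?S" for p q
  proof -
    obtain x y a b where eq: "p = (x, y)" "q = (a, b)" by (cases p, cases q)
    have "y \<rightarrow>\<^sup>* a" using that eq in_verts by (intro conn) blast+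
    with reach that(1) eq obtain d where "d \<rightarrow> a" "(p, (d, a)) \<in> ?M\<^sup>*" by blast
    then show ?thesis
      using that(2) eq by (auto intro: rtrancl_into_rtrancl)
  qed
  have joined: "?S \<times> ?S \<subseteq> ?M\<^sup>*"
    by (rule subsetI, erule SigmaE, hypsubst, rule reach_pair)
  have img: "fst ` ?S = verts G" "snd ` ?S = verts G"
    using deg in_verts sym by force+
  have ne: "?S \<noteq> {}"
    using deg assms(3) by auto
  have apart: "1 \<le> graph_dist G x y" if "(x, y) \<in> ?S" for x y
    using that adj_not_same by (intro graph_dist_ge_1) auto
  have sub: "?M \<subseteq> ?S \<times> ?S" by auto
  obtain l f g where fg: "1 \<le> l" "f ` {1..l} = verts G" "g ` {1..l} = verts G"
    "\<And>i. i \<in> {1..<l} \<Longrightarrow> ((f i, g i), (f (i + 1), g (i + 1))) \<in> ?M"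
    "\<And>x y x' y'. ((x, y), (x', y')) \<in> ?M
      \<Longrightarrow> \<exists>i\<in>{1..<l}. f i = x \<and> g i = y \<and> f (i + 1) = x' \<and> g (i + 1) = y'"
    "1 \<le> min_dist G l f g"
    using tracks_of_moves[OF ne sub finite_verts joined img apart] by blast
  have "visits_edges G l f" "visits_edges G l g"
    unfolding visits_edges_def
  proof (safe)
    fix x y assume xy: "x \<rightarrow> y"
    have "((x, y), (y, x)) \<in> ?M" using xy sym by auto
    from fg(5)[OF this] obtain i where
      "i \<in> {1..<l}" "f i = x" "g i = y" "f (i + 1) = y" "g (i + 1) = x"
      by blast
    then show "\<exists>i\<in>{1..<l}. {f i, f (i + 1)} = {x, y}" "\<exists>i\<in>{1..<l}. {g i, g (i + 1)} = {x, y}"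
      by (metis insert_commute)+
  qed
  moreover have "track G l f" "track G l g"
    unfolding track_def using fg(2-4) by auto
  ultimately show ?thesis
    using fg(1,6) unfolding sweep_def by blast
qed

text \<open>
  The hypothesis says that removing a vertex \<open>y\<close> leaves a connected graph, so one token can get anywhere
  while the other one waits on \<open>y\<close>. Hence \<open>(x, y)\<close> can be turned into \<open>(a, b)\<close> by moving first one
  and then the other token, unless \<open>a = y\<close>. In that case the second token first leaves \<open>y\<close> for a third vertex,
  and then the first token, and finally the second one, goes to its target.
\<close>

lemma (in graph) opposite_sweeps:
  assumes conn: "\<And>x x' y. x \<in> verts G - {y} \<Longrightarrow> x' \<in> verts G - {y}
      \<Longrightarrow> (x, x') \<in> (arcs_ends G \<inter> (- {y}) \<times> (- {y}))\<^sup>*"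
    and card: "3 \<le> card (verts G)"
  shows "\<exists>l f g. 1 \<le> l \<and> lazy_sweep G l f \<and> lazy_sweep G l g \<and> opposite G l f g
    \<and> 1 \<le> min_dist G l f g"
proof -
  let ?S = "{(x, y). x \<in> verts G \<and> y \<in> verts G \<and> x \<noteq> y}"
  let ?M = "{((x, y), (x', y')). x \<noteq> y \<and> x' \<noteq> y'
    \<and> (x \<rightarrow> x' \<and> y = y' \<and> y \<in> verts G \<or> x = x' \<and> x \<in> verts G \<and> y \<rightarrow> y')}"
  have in_verts: "x \<in> verts G" "y \<in> verts G" if "x \<rightarrow> y" for x y
    using that by auto
  have third: "\<exists>z\<in>verts G. z \<noteq> x \<and> z \<noteq> y" for x y
  proof (rule ccontr)
    assume "\<not> ?thesis"
    then have "verts G \<subseteq> {x, y}" by blast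
    then have "card (verts G) \<le> card {x, y}" by (intro card_mono) auto
    also have "\<dots> \<le> 2" by (simp add: card_insert_if)
    finally show False using card by simp
  qed
  have fst_move: "((x, y), (x', y)) \<in> ?M\<^sup>*"
    if "x \<in> verts G" "x' \<in> verts G" "y \<in> verts G" "x \<noteq> y" "x' \<noteq> y" for x x' y
  proof -
    have "(x, x') \<in> (arcs_ends G \<inter> (- {y}) \<times> (- {y}))\<^sup>*"
      using that by (intro conn) auto
    then show ?thesis
    proof (induction rule: rtrancl_induct)
      case (step a b)
      from step.hyps(2) that(3) have "((a, y), (b, y)) \<in> ?M" by auto
      with step.IH show ?case by (rule rtrancl_into_rtrancl)
    qed simp
  qed
  have snd_move: "((x, y), (x, y')) \<in> ?M\<^sup>*"
    if "y \<in> verts G" "y' \<in> verts G" "x \<in> verts G" "x \<noteq> y" "x \<noteq> y'" for x y y'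
  proof -
    have "(y, y') \<in> (arcs_ends G \<inter> (- {x}) \<times> (- {x}))\<^sup>*"
      using that by (intro conn) auto
    then show ?thesis
    proof (induction rule: rtrancl_induct)
      case (step a b)
      from step.hyps(2) that(3) have "((x, a), (x, b)) \<in> ?M" by auto
      with step.IH show ?case by (rule rtrancl_into_rtrancl)
    qed simp
  qed
  have reach_pair: "(p, q) \<in> ?M\<^sup>*" if "p \<in> ?S" "q \<in> ?S" for p q
  proof -
    obtain x y a b where eq: "p = (x, y)" "q = (a, b)" by (cases p, cases q)
    have V: "x \<in> verts G" "y \<in> verts G" "a \<in> verts G" "b \<in> verts G" "x \<noteq> y" "a \<noteq> b"
      using that eq by auto
    show ?thesis
    proof (cases "a = y")
      case False
      have "((x, y), (a, y)) \<in> ?M\<^sup>*" using V False by (intro fst_move) auto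
      also have "((a, y), (a, b)) \<in> ?M\<^sup>*" using V False by (intro snd_move) auto
      finally show ?thesis unfolding eq .
    next
      case True
      obtain z where z: "z \<in> verts G" "z \<noteq> x" "z \<noteq> y" using third by blast
      have "((x, y), (x, z)) \<in> ?M\<^sup>*" using V z by (intro snd_move) auto
      also have "((x, z), (a, z)) \<in> ?M\<^sup>*" using V z True by (intro fst_move) auto
      also have "((a, z), (a, b)) \<in> ?M\<^sup>*" using V z True by (intro snd_move) auto
      finally show ?thesis unfolding eq .
    qed
  qed
  have joined: "?S \<times> ?S \<subseteq> ?M\<^sup>*"
    by (rule subsetI, erule SigmaE, hypsubst, rule reach_pair)
  have img: "fst ` ?S = verts G" "snd ` ?S = verts G"
    using third by force+
  have ne: "?S \<noteq> {}"
    using third by blast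
  have apart: "1 \<le> graph_dist G x y" if "(x, y) \<in> ?S" for x y
  proof -
    obtain z where z: "z \<in> verts G" "z \<noteq> x" "z \<noteq> y" using third by blast
    have "(x, y) \<in> (arcs_ends G \<inter> (- {z}) \<times> (- {z}))\<^sup>*"
      using that z by (intro conn) auto
    then have "(x, y) \<in> (arcs_ends G)\<^sup>*"
      by (rule rtrancl_mono[THEN subsetD, rotated]) auto
    then have "x \<rightarrow>\<^sup>* y"
      using that by (simp add: reachable_conv rtrancl_on_rtranclI)
    then show ?thesis using that by (intro graph_dist_ge_1) auto
  qed
  have sub: "?M \<subseteq> ?S \<times> ?S" using in_verts by auto
  obtain l f g where fg: "1 \<le> l" "f ` {1..l} = verts G" "g ` {1..l} = verts G"
    "\<And>i. i \<in> {1..<l} \<Longrightarrow> ((f i, g i), (f (i + 1), g (i + 1))) \<in> ?M"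
    "\<And>x y x' y'. ((x, y), (x', y')) \<in> ?M
      \<Longrightarrow> \<exists>i\<in>{1..<l}. f i = x \<and> g i = y \<and> f (i + 1) = x' \<and> g (i + 1) = y'"
    "1 \<le> min_dist G l f g"
    using tracks_of_moves[OF ne sub finite_verts joined img apart] by blast
  have "visits_edges G l f" "visits_edges G l g"
    unfolding visits_edges_def
  proof (safe)
    fix x y assume xy: "x \<rightarrow> y"
    obtain z where z: "z \<in> verts G" "z \<noteq> x" "z \<noteq> y" using third by blast
    have "((x, z), (y, z)) \<in> ?M" "((z, x), (z, y)) \<in> ?M" using xy z by auto
    from this[THEN fg(5)]
    show "\<exists>i\<in>{1..<l}. {f i, f (i + 1)} = {x, y}" "\<exists>i\<in>{1..<l}. {g i, g (i + 1)} = {x, y}"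
      by metis+
  qed
  moreover have step: "f i \<rightarrow> f (i + 1) \<and> g i = g (i + 1) \<or> f i = f (i + 1) \<and> g i \<rightarrow> g (i + 1)"
    if "i \<in> {1..<l}" for i
    using fg(4)[OF that] by auto
  then have "lazy_track G l f" "lazy_track G l g"
    unfolding lazy_track_def using fg(2,3) by blast+
  moreover have "opposite G l f g"
    unfolding opposite_def using step adj_not_same by metis
  ultimately show ?thesis
    using fg(1,6) unfolding lazy_sweep_def by blast
qed

section \<open>The complete graph with one subdivided edge\<close>

text \<open>
  The set removed from the adjacency relation in \<open>adj_iff\<close> consists of the subdivided edge and of the
  pairs formed by the new vertex \<open>w\<close> and a vertex in \<open>R\<close>.
\<close>

locale subdivided_complete = graph G for G :: "('a, 'b) pre_digraph" (structure) +
  fixes u v w :: 'a and R :: "'a set"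
  assumes verts_eq: "verts G = {u, v, w} \<union> R"
    and distinct: "u \<noteq> v" "u \<noteq> w" "v \<noteq> w" "u \<notin> R" "v \<notin> R" "w \<notin> R"
    and two_others: "\<exists>r\<in>R. \<exists>r'\<in>R. r \<noteq> r'"
    and adj_iff: "x \<rightarrow> y \<longleftrightarrow> x \<in> verts G \<and> y \<in> verts G \<and> x \<noteq> y
      \<and> (x, y) \<notin> {(u, v), (v, u)} \<union> {w} \<times> R \<union> R \<times> {w}"
begin

definition far :: "('a \<times> 'a) set" where
  "far = {(u, v), (v, u)} \<union> {w} \<times> R \<union> R \<times> {w}"

lemma far_sym: "(x, y) \<in> far \<Longrightarrow> (y, x) \<in> far"
  by (auto simp: far_def)

lemma far_in_verts: "(x, y) \<in> far \<Longrightarrow> x \<in> verts G \<and> y \<in> verts G"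
  by (auto simp: far_def verts_eq)

lemma far_nonempty: "far \<noteq> {}"
  by (simp add: far_def)

lemma fst_far: "fst ` far = verts G" and snd_far: "snd ` far = verts G"
  using two_others by (force simp: far_def verts_eq)+

lemma far_common_neighbour:
  assumes "(x, y) \<in> far"
  shows "\<exists>z. x \<rightarrow> z \<and> z \<rightarrow> y"
proof -
  have "u \<rightarrow> w" "w \<rightarrow> v" "v \<rightarrow> w" "w \<rightarrow> u"
    using distinct by (auto simp: adj_iff verts_eq)
  moreover have "u \<rightarrow> r" "r \<rightarrow> u" if "r \<in> R" for r
    using distinct that by (auto simp: adj_iff verts_eq)
  ultimately show ?thesis
    using assms unfolding far_def by blast
qed

lemma cases_verts:
  assumes "x \<in> verts G" "y \<in> verts G"
  shows "x = y \<or> x \<rightarrow> y \<or> (x, y) \<in> far"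
  using assms unfolding adj_iff far_def by blast

lemma all_reachable:
  assumes "x \<in> verts G" "y \<in> verts G"
  shows "x \<rightarrow>\<^sup>* y"
  using cases_verts[OF assms] far_common_neighbour[of x y] assms
  by (auto intro: reachable_trans)

lemma graph_dist_bound:
  assumes "x \<in> verts G" "y \<in> verts G"
  shows "graph_dist G x y \<le> 2"
  using cases_verts[OF assms]
proof (elim disjE)
  assume "(x, y) \<in> far"
  then show ?thesis
    using far_common_neighbour graph_dist_le_2 by blast
qed (use assms graph_dist_self graph_dist_le_1 in fastforce)+

lemma graph_dist_ge_2_iff:
  assumes "x \<in> verts G" "y \<in> verts G"
  shows "2 \<le> graph_dist G x y \<longleftrightarrow> (x, y) \<in> far"
proof
  assume "2 \<le> graph_dist G x y"
  then show "(x, y) \<in> far"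
    using cases_verts[OF assms] graph_dist_self[of x] graph_dist_le_1[of x y] assms by fastforce
next
  assume far: "(x, y) \<in> far"
  then have "x \<noteq> y" "\<not> x \<rightarrow> y"
    using distinct by (auto simp: far_def adj_iff)
  then show "2 \<le> graph_dist G x y"
    using all_reachable[OF assms] by (intro graph_dist_ge_2)
qed

lemma far_graph_dist: "(x, y) \<in> far \<Longrightarrow> 2 \<le> graph_dist G x y"
  using far_in_verts graph_dist_ge_2_iff by blast

lemma min_dist_bound:
  assumes "1 \<le> l" and "f ` {1..l} = verts G" and "g ` {1..l} = verts G"
  shows "min_dist G l f g \<le> 2"
proof -
  have "min_dist G l f g \<le> graph_dist G (f 1) (g 1)"
    using assms(1) by (intro min_dist_le) simp
  also have "\<dots> \<le> 2"
    using assms by (intro graph_dist_bound) auto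
  finally show ?thesis .
qed

lemma far_if_min_dist:
  assumes "\<not> min_dist G l f g \<le> 1" and "f ` {1..l} = verts G" and "g ` {1..l} = verts G"
    and "i \<in> {1..l}"
  shows "(f i, g i) \<in> far"
proof -
  have "2 \<le> graph_dist G (f i) (g i)"
    using min_dist_le[OF assms(4), of G f g] assms(1) by simp
  moreover have "f i \<in> verts G" "g i \<in> verts G"
    using assms(2-4) by auto
  ultimately show ?thesis
    by (simp add: graph_dist_ge_2_iff)
qed

text \<open>
  A token on \<open>R\<close> is far only from \<open>w\<close>. So while \<open>f\<close> traverses an edge inside \<open>R\<close>, the
  other sweep would have to rest on \<open>w\<close>.
\<close>

lemma sweeps_min_dist_le_1:
  assumes "sweep G l f" "sweep G l g"
  shows "min_dist G l f g \<le> 1"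
proof (rule ccontr)
  assume contr: "\<not> ?thesis"
  have img: "f ` {1..l} = verts G" "g ` {1..l} = verts G"
    using assms by (auto simp: sweep_def track_def)
  obtain r r' where r: "r \<in> R" "r' \<in> R" "r \<noteq> r'"
    using two_others by blast
  then have "r \<rightarrow> r'"
    using distinct by (auto simp: adj_iff verts_eq)
  then obtain i where i: "i \<in> {1..<l}" "{f i, f (i + 1)} = {r, r'}"
    using assms(1) unfolding sweep_def visits_edges_def by blast
  have "f i \<in> R" "f (i + 1) \<in> R"
    using i(2) r by auto
  moreover have "(f i, g i) \<in> far" "(f (i + 1), g (i + 1)) \<in> far"
    using far_if_min_dist[OF contr img] i(1) by auto
  ultimately have "g i = w" "g (i + 1) = w"
    using distinct by (auto simp: far_def)
  moreover have "g i \<rightarrow> g (i + 1)"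
    using assms(2) i(1) by (auto simp: sweep_def track_def)
  ultimately show False
    using adj_not_same by simp
qed

text \<open>
  A vertex \<open>u\<close> in the first coordinate forces \<open>v\<close> in the second. If one token of the pair \<open>(u, v)\<close>
  moves alone, it has to keep away from the other token, which it cannot: \<open>u\<close> is the only vertex far
  from \<open>v\<close>, and conversely.
\<close>

lemma no_opposite_far_step:
  assumes "(x, y) \<in> far" "(x', y') \<in> far"
    and "x \<rightarrow> x' \<and> y = y' \<or> x = x' \<and> y \<rightarrow> y'"
  shows "x \<noteq> u" and "x' \<noteq> u"
  using assms distinct by (auto simp: far_def adj_iff)

text \<open>
  The first track visits \<open>u\<close>, and it has length at least 2 since it also visits \<open>v\<close>. So some
  step begins or ends with the first token on \<open>u\<close>, which a far pair does not admit.
\<close>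

lemma opposite_min_dist_le_1:
  assumes "lazy_track G l f" "lazy_track G l g" "opposite G l f g"
  shows "min_dist G l f g \<le> 1"
proof (rule ccontr)
  assume contr: "\<not> ?thesis"
  have img: "f ` {1..l} = verts G" "g ` {1..l} = verts G"
    using assms(1,2) by (auto simp: lazy_track_def)
  have step: "f i \<noteq> u" "f (i + 1) \<noteq> u" if "i \<in> {1..<l}" for i
  proof -
    have "(f i, g i) \<in> far" "(f (i + 1), g (i + 1)) \<in> far"
      using far_if_min_dist[OF contr img] that by auto
    moreover have "f i \<rightarrow> f (i + 1) \<and> g i = g (i + 1) \<or> f i = f (i + 1) \<and> g i \<rightarrow> g (i + 1)"
      using assms that unfolding lazy_track_def opposite_def by blast
    ultimately show "f i \<noteq> u" "f (i + 1) \<noteq> u"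
      using no_opposite_far_step by blast+
  qed
  have "u \<in> f ` {1..l}" "v \<in> f ` {1..l}"
    using img(1) by (auto simp: verts_eq)
  then obtain i j where ij: "i \<in> {1..l}" "f i = u" "j \<in> {1..l}" "f j = v"
    by blast
  then have "i \<noteq> j" using distinct by auto
  \<comment> \<open>The step at \<open>u\<close> starts at time \<open>i\<close>, or ends there if \<open>i\<close> is the last time.\<close>
  then have "i \<in> {1..<l} \<or> i - 1 \<in> {1..<l} \<and> i = i - 1 + 1"
    using ij by auto
  then show False
    using step ij(2) by metis
qed

definition direct_far_moves :: "(('a \<times> 'a) \<times> ('a \<times> 'a)) set" where
  "direct_far_moves = {((x, y), (x', y')). (x, y) \<in> far \<and> (x', y') \<in> far \<and> x \<rightarrow> x' \<and> y \<rightarrow> y'}"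

definition lazy_far_moves :: "(('a \<times> 'a) \<times> ('a \<times> 'a)) set" where
  "lazy_far_moves = {((x, y), (x', y')). (x, y) \<in> far \<and> (x', y') \<in> far
    \<and> (x \<rightarrow> x' \<or> x = x') \<and> (y \<rightarrow> y' \<or> y = y')}"

text \<open>
  The state \<open>(u, v)\<close> is a hub: it is adjacent to all \<open>(w, r)\<close> and \<open>(r, w)\<close>, and it is reached from \<open>(v, u)\<close> in two
  moves through some \<open>(w, r)\<close>. A direct passage from \<open>(v, u)\<close> is impossible as \<open>u\<close> and \<open>v\<close> are not adjacent.
\<close>

lemma direct_far_moves_connected: "far \<times> far \<subseteq> direct_far_moves\<^sup>*"
proof (intro subsetI, elim SigmaE, hypsubst,
    rule strongly_connected_relI[where S = far and c = "(u, v)"])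
  show "sym direct_far_moves"
    using sym_arcs by (auto simp: sym_def direct_far_moves_def intro: arcs_ends_symmetric)
  have wr: "((w, r), (u, v)) \<in> direct_far_moves" "((r, w), (u, v)) \<in> direct_far_moves"
    "((v, u), (w, r)) \<in> direct_far_moves" if "r \<in> R" for r
    using distinct that by (auto simp: direct_far_moves_def far_def adj_iff verts_eq)
  obtain r where r: "r \<in> R" using two_others by blast
  show "(p, (u, v)) \<in> direct_far_moves\<^sup>*" if "p \<in> far" for p
  proof -
    have "((v, u), (u, v)) \<in> direct_far_moves\<^sup>*"
      using wr(3,1)[OF r] by (meson converse_rtrancl_into_rtrancl r_into_rtrancl)
    then show ?thesis
      using that wr(1,2) unfolding far_def by auto
  qed
qed

lemma lazy_far_moves_connected: "far \<times> far \<subseteq> lazy_far_moves\<^sup>*"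
proof -
  have "direct_far_moves \<subseteq> lazy_far_moves"
    by (auto simp: direct_far_moves_def lazy_far_moves_def)
  then show ?thesis
    using direct_far_moves_connected rtrancl_mono by blast
qed

text \<open>
  While one token traverses an edge, the other one can keep the pair far. For an edge inside
  \<open>R\<close> it waits on \<open>w\<close>; for the edge \<open>uw\<close> it goes from \<open>v\<close> to some \<open>r \<in> R\<close>; for an edge \<open>ur\<close> it goes from
  \<open>v\<close> to \<open>w\<close>; and likewise with \<open>u\<close> and \<open>v\<close> interchanged or the direction reversed.
\<close>

lemma far_partner:
  assumes "x \<rightarrow> x'"
  obtains y y' where "((x, y), (x', y')) \<in> lazy_far_moves"
proof -
  obtain r where "r \<in> R" using two_others by blast
  then have "\<exists>y y'. (x, y) \<in> far \<and> (x', y') \<in> far \<and> (y \<rightarrow> y' \<or> y = y')"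
    using assms distinct unfolding adj_iff far_def verts_eq by blast
  then show thesis
    using that assms by (auto simp: lazy_far_moves_def)
qed

lemma lazy_sweeps_far:
  "\<exists>l f g. 1 \<le> l \<and> lazy_sweep G l f \<and> lazy_sweep G l g \<and> 2 \<le> min_dist G l f g"
proof -
  have sub: "lazy_far_moves \<subseteq> far \<times> far"
    by (auto simp: lazy_far_moves_def)
  obtain l f g where fg: "1 \<le> l" "f ` {1..l} = verts G" "g ` {1..l} = verts G"
    "\<And>i. i \<in> {1..<l} \<Longrightarrow> ((f i, g i), (f (i + 1), g (i + 1))) \<in> lazy_far_moves"
    "\<And>x y x' y'. ((x, y), (x', y')) \<in> lazy_far_moves
      \<Longrightarrow> \<exists>i\<in>{1..<l}. f i = x \<and> g i = y \<and> f (i + 1) = x' \<and> g (i + 1) = y'"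
    "2 \<le> min_dist G l f g"
    using tracks_of_moves[OF far_nonempty sub finite_verts lazy_far_moves_connected
      fst_far snd_far far_graph_dist] by blast
  have "visits_edges G l f" "visits_edges G l g"
    unfolding visits_edges_def
  proof (safe)
    fix x x' assume "x \<rightarrow> x'"
    then obtain y y' where "((x, y), (x', y')) \<in> lazy_far_moves" by (rule far_partner)
    moreover from this have "((y, x), (y', x')) \<in> lazy_far_moves"
      by (auto simp: lazy_far_moves_def far_sym)
    ultimately
    show "\<exists>i\<in>{1..<l}. {f i, f (i + 1)} = {x, x'}" "\<exists>i\<in>{1..<l}. {g i, g (i + 1)} = {x, x'}"
      using fg(5) by metis+
  qed
  moreover have "lazy_track G l f" "lazy_track G l g"
    unfolding lazy_track_def using fg(2-4) by (auto simp: lazy_far_moves_def)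
  ultimately show ?thesis
    using fg(1,6) unfolding lazy_sweep_def by blast
qed

lemma tracks_far:
  "\<exists>l f g. 1 \<le> l \<and> track G l f \<and> track G l g \<and> 2 \<le> min_dist G l f g"
proof -
  have sub: "direct_far_moves \<subseteq> far \<times> far"
    by (auto simp: direct_far_moves_def)
  obtain l f g where fg: "1 \<le> l" "f ` {1..l} = verts G" "g ` {1..l} = verts G"
    "\<And>i. i \<in> {1..<l} \<Longrightarrow> ((f i, g i), (f (i + 1), g (i + 1))) \<in> direct_far_moves"
    "\<And>x y x' y'. ((x, y), (x', y')) \<in> direct_far_moves
      \<Longrightarrow> \<exists>i\<in>{1..<l}. f i = x \<and> g i = y \<and> f (i + 1) = x' \<and> g (i + 1) = y'"
    "2 \<le> min_dist G l f g"
    using tracks_of_moves[OF far_nonempty sub finite_verts direct_far_moves_connected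
      fst_far snd_far far_graph_dist] by blast
  have "f i \<rightarrow> f (i + 1) \<and> g i \<rightarrow> g (i + 1)" if "i \<in> {1..<l}" for i
    using fg(4)[OF that] by (simp add: direct_far_moves_def)
  then have "track G l f" "track G l g"
    unfolding track_def using fg(2,3) by blast+
  with fg(1,6) show ?thesis by blast
qed

text \<open>
  Every vertex other than \<open>w\<close> is adjacent or equal to a vertex \<open>r \<in> R\<close> different from \<open>y\<close>, and \<open>w\<close>
  reaches \<open>r\<close> through whichever of \<open>u\<close>, \<open>v\<close> has not been removed.
\<close>

lemma connected_without_vertex:
  assumes "x \<in> verts G - {y}" "x' \<in> verts G - {y}"
  shows "(x, x') \<in> (arcs_ends G \<inter> (- {y}) \<times> (- {y}))\<^sup>*" (is "_ \<in> ?E\<^sup>*")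
proof -
  obtain r where r: "r \<in> R" "r \<noteq> y" using two_others by blast
  show ?thesis
  proof (rule strongly_connected_relI[OF _ _ assms])
    show "sym ?E"
      using sym_arcs by (auto simp: sym_def intro: arcs_ends_symmetric)
    show "(x, r) \<in> ?E\<^sup>*" if x: "x \<in> verts G - {y}" for x
    proof (cases "x = w")
      case False
      then have "x = r \<or> (x, r) \<in> ?E"
        using x r distinct by (auto simp: adj_iff verts_eq)
      then show ?thesis by auto
    next
      case True
      obtain t where t: "t \<in> {u, v}" "t \<noteq> y" using distinct(1) by blast
      then have "(w, t) \<in> ?E" "(t, r) \<in> ?E"
        using x True r distinct by (auto simp: adj_iff verts_eq)
      then show ?thesis
        using True by (meson converse_rtrancl_into_rtrancl r_into_rtrancl)
    qed
  qed
qed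

lemma three_verts: "3 \<le> card (verts G)"
proof -
  have "card {u, v, w} \<le> card (verts G)"
    by (rule card_mono) (auto simp: verts_eq[symmetric], auto simp: verts_eq)
  then show ?thesis using distinct by simp
qed

lemma sweeps_apart: "\<exists>l f g. 1 \<le> l \<and> sweep G l f \<and> sweep G l g \<and> 1 \<le> min_dist G l f g"
proof (rule shifted_sweeps[OF all_reachable])
  show "\<exists>y. x \<rightarrow> y" if "x \<in> verts G" for x
    proof -
    have "x \<in> fst ` far" using that by (simp add: fst_far)
    then obtain y where "(x, y) \<in> far" by auto
    then show ?thesis using far_common_neighbour by blast
  qed
  show "verts G \<noteq> {}" by (simp add: verts_eq)
qed

lemma strong_spans: "strong_vertex_span G = 2" "strong_edge_span G = 2"
proof -
  obtain l f g where fg: "1 \<le> l" "lazy_sweep G l f" "lazy_sweep G l g" "2 \<le> min_dist G l f g"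
    using lazy_sweeps_far by blast
  then have tr: "lazy_track G l f" "lazy_track G l g"
    by (auto simp: lazy_sweep_def)
  show "strong_vertex_span G = 2"
    unfolding strong_vertex_span_def
    by (rule Max_nat_eqI[OF _ _ fg(4)])
      (use fg(1) tr min_dist_bound in \<open>auto simp: lazy_track_def\<close>)
  show "strong_edge_span G = 2"
    unfolding strong_edge_span_def
    by (rule Max_nat_eqI[OF _ _ fg(4)])
      (use fg(1-3) min_dist_bound in \<open>auto simp: lazy_sweep_def lazy_track_def\<close>)
qed

lemma direct_spans: "direct_vertex_span G = 2" "direct_edge_span G = 1"
proof -
  obtain l f g where fg: "1 \<le> l" "track G l f" "track G l g" "2 \<le> min_dist G l f g"
    using tracks_far by blast
  show "direct_vertex_span G = 2"
    unfolding direct_vertex_span_def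
    by (rule Max_nat_eqI[OF _ _ fg(4)]) (use fg(1-3) min_dist_bound in \<open>auto simp: track_def\<close>)
next
  obtain l f g where fg: "1 \<le> l" "sweep G l f" "sweep G l g" "1 \<le> min_dist G l f g"
    using sweeps_apart by blast
  show "direct_edge_span G = 1"
    unfolding direct_edge_span_def
    by (rule Max_nat_eqI[OF _ _ fg(4)]) (use fg(1-3) sweeps_min_dist_le_1 in auto)
qed

lemma cartesian_spans: "cartesian_vertex_span G = 1" "cartesian_edge_span G = 1"
proof -
  obtain l f g where fg: "1 \<le> l" "lazy_sweep G l f" "lazy_sweep G l g" "opposite G l f g"
      "1 \<le> min_dist G l f g"
    using opposite_sweeps[OF connected_without_vertex three_verts] by blast
  then have tr: "lazy_track G l f" "lazy_track G l g"
    by (auto simp: lazy_sweep_def)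
  show "cartesian_vertex_span G = 1"
    unfolding cartesian_vertex_span_def
    by (rule Max_nat_eqI[OF _ _ fg(5)]) (use fg(1,4) tr opposite_min_dist_le_1 in auto)
  show "cartesian_edge_span G = 1"
    unfolding cartesian_edge_span_def
    by (rule Max_nat_eqI[OF _ _ fg(5)])
      (use fg(1-4) opposite_min_dist_le_1 in \<open>auto simp: lazy_sweep_def\<close>)
qed

end

lemma subdivided_complete_subdivide:
  assumes "4 \<le> n" and "complete_digraph n (with_proj K)" and "(u, v) \<in> parcs K"
    and "w \<notin> pverts K"
  shows "subdivided_complete (with_proj (subdivide K (u, v) w)) u v w (pverts K - {u, v})"
proof -
  interpret K: pair_graph K
    using assms(2) by (rule pair_graphI_complete)
  let ?H = "subdivide K (u, v) w" and ?R = "pverts K - {u, v}"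
  have K: "finite (pverts K)" "card (pverts K) = n"
      "parcs K = {(x, y). (x, y) \<in> pverts K \<times> pverts K \<and> x \<noteq> y}"
    using assms(2) by (auto simp: complete_digraph_pair_def)
  have uv: "u \<in> pverts K" "v \<in> pverts K" "u \<noteq> v"
    using assms(3) K(3) by auto
  interpret H: pair_graph ?H
    using assms(3,4) by (intro K.pair_graph_subdivide)
  have "card ?R = n - 2"
    using K(1,2) uv by (simp add: card_Diff_subset)
  then have "2 \<le> card ?R" using assms(1) by simp
  then have others: "\<exists>r\<in>?R. \<exists>r'\<in>?R. r \<noteq> r'"
    by (metis card_le_Suc0_iff_eq not_less_eq_eq numeral_2_eq_2 K(1) finite_Diff)
  have "graph (with_proj ?H)"
    by unfold_locales
  then show ?thesis
    unfolding subdivided_complete_def subdivided_complete_axioms_def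
    using uv assms(4) others by (auto simp: subdivide.simps K(3))
qed

theorem theorem5p4:
  fixes K :: "'a pair_pre_digraph" and Kplus :: "('a, 'a \<times> 'a) pre_digraph" and n :: nat and u v w :: 'a
  assumes "n \<ge> 4"
    and "complete_digraph n (with_proj K)"
    and "(u, v) \<in> parcs K"
    and "w \<notin> pverts K"
    and "Kplus = with_proj (subdivide K (u, v) w)"
  shows "strong_vertex_span Kplus = 2 \<and> strong_edge_span Kplus = 2
    \<and> direct_vertex_span Kplus = 2 \<and> direct_edge_span Kplus = 1
    \<and> cartesian_vertex_span Kplus = 1 \<and> cartesian_edge_span Kplus = 1"
proof -
  interpret subdivided_complete Kplus u v w "pverts K - {u, v}"
    unfolding assms(5) using assms(1-4) by (rule subdivided_complete_subdivide)
  show ?thesis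
    using strong_spans direct_spans cartesian_spans by simp
qed

end
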